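(* Let $S=\{i_1,i_2,\dots,i_s\}$ be $n$-admissible. Then $\#\widehat{P}_B(S,n)$ is even if $S$ contains some even number or if $n$ is odd, and $\#\widehat{P}_B(S,n)$ is odd otherwise (i.e. when all elements of $S$ are odd and $n$ is even).
   Context: $B_n$ is the set of signed permutations $\pi=\pi_1\cdots\pi_n$: words with each $\pi_i\in\{-n,\dots,-1,1,\dots,n\}$ and $\{|\pi_1|,\dots,|\pi_n|\}=\{1,\dots,n\}$. Set $\pi_0=0$. An index $i\in\{1,\dots,n-1\}$ is a peak of $\pi$ if $\pi_{i-1}<\pi_i>\pi_{i+1}$. $\widehat{P}_B(S,n)$ is the set of $\pi\in B_n$ whose peak set (in this sense) equals $S$. $S$ is $n$-admissible if $\widehat{P}_B(S,n)\neq\emptyset$. *)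

theory Defs
  imports Main
begin

text \<open>A word $\pi_1 \cdots \pi_n$ is the list of its letters, so list position \<open>i - 1\<close> holds $\pi_i$.\<close>

definition signed_perms :: "nat \<Rightarrow> int list set" where
  "signed_perms n = {\<pi>. length \<pi> = n
     \<and> set \<pi> \<subseteq> {- int n .. -1} \<union> {1 .. int n}
     \<and> abs ` set \<pi> = {1 .. int n}}"

text \<open>Prepending 0 gives the convention $\pi_0 = 0$ and makes the indices one-based.\<close>

definition entry :: "int list \<Rightarrow> nat \<Rightarrow> int" where
  "entry \<pi> i = (0 # \<pi>) ! i"

definition peak_set :: "int list \<Rightarrow> nat set" where
  "peak_set \<pi> = {i \<in> {1..<length \<pi>}.
     entry \<pi> (i - 1) < entry \<pi> i \<and> entry \<pi> i > entry \<pi> (i + 1)}"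

definition PB_hat :: "nat set \<Rightarrow> nat \<Rightarrow> int list set" where
  "PB_hat S n = {\<pi> \<in> signed_perms n. peak_set \<pi> = S}"

definition admissible :: "nat \<Rightarrow> nat set \<Rightarrow> bool" where
  "admissible n S \<longleftrightarrow> PB_hat S n \<noteq> {}"

lemma finite_signed_perms: "finite (signed_perms n)"
proof (rule finite_subset)
  show "signed_perms n \<subseteq> {\<pi>. set \<pi> \<subseteq> {- int n .. -1} \<union> {1 .. int n} \<and> length \<pi> = n}"
    by (auto simp: signed_perms_def)
qed (simp add: finite_lists_length_eq)

lemma finite_PB_hat: "finite (PB_hat S n)"
  unfolding PB_hat_def by (simp add: finite_signed_perms)

end

theory Submission
  imports Defs "HOL-Library.Z2" "HOL-Library.Disjoint_Sets"
begin

text \<open>Let \<open>k\<close> be least with $|\pi_k| \ne k$. The positions below \<open>k\<close> hold the letters of absolute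
  value below \<open>k\<close>, so the letter of absolute value \<open>k\<close> sits beyond position \<open>k\<close> and both its
  neighbours have larger absolute value; changing its sign leaves all comparisons of neighbours
  intact. This is a fixed-point-free involution, so modulo 2 only the \<open>\<pi>\<close> with $|\pi_i| = i$
  for all \<open>i\<close> count. For these, \<open>i\<close> is a peak iff $\pi_i > 0 > \pi_{i+1}$, and the sign patterns
  are counted by recursion on \<open>n\<close>, separated by the sign of the last letter.\<close>

text \<open>In characteristic 2 the summands 1 at \<open>x\<close> and at \<open>f x\<close> cancel,
  so the cardinality vanishes in \<open>bit\<close>.\<close>

lemma even_card_involution:
  assumes "\<And>x. x \<in> A \<Longrightarrow> f x \<in> A" "\<And>x. x \<in> A \<Longrightarrow> f (f x) = x"
    and "\<And>x. x \<in> A \<Longrightarrow> f x \<noteq> x"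
  shows "even (card A)"
proof -
  have "(\<Sum>x\<in>A. 1 :: bit) = 0"
    by (rule sum_involution_eq_0[where h = f]) (use assms in simp_all)
  then have "even (of_nat (card A) :: bit)" by simp
  then show ?thesis by (simp only: even_of_nat)
qed

section \<open>Absolute values of the letters\<close>

lemma entry_0 [simp]: "entry w 0 = 0"
  by (simp add: entry_def)

lemma entry_Suc [simp]: "entry w (Suc i) = w ! i"
  by (simp add: entry_def)

lemma signed_perms_length: "w \<in> signed_perms n \<Longrightarrow> length w = n"
  by (simp add: signed_perms_def)

lemma abs_entry_image:
  assumes "w \<in> signed_perms n"
  shows "(\<lambda>i. \<bar>entry w i\<bar>) ` {0..n} = {0..int n}"
proof -
  have "{0..n} = insert 0 (Suc ` {..<n})"
    by (auto simp: image_iff) (metis Suc_le_lessD lessThan_iff not0_implies_Suc)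
  then have "(\<lambda>i. \<bar>entry w i\<bar>) ` {0..n} = insert 0 (abs ` ((!) w ` {..<n}))"
    by (simp add: image_image)
  also have "(!) w ` {..<n} = set w"
    using signed_perms_length[OF assms] by (auto simp: in_set_conv_nth)
  also have "abs ` set w = {1..int n}" using assms by (simp add: signed_perms_def)
  also have "insert 0 {1..int n} = {0..int n}" by auto
  finally show ?thesis .
qed

lemma inj_on_abs_entry:
  assumes "w \<in> signed_perms n"
  shows "inj_on (\<lambda>i. \<bar>entry w i\<bar>) {0..n}"
  by (rule eq_card_imp_inj_on) (simp_all add: abs_entry_image[OF assms])

section \<open>The sign change and its effect on comparisons\<close>

definition flip :: "int \<Rightarrow> int list \<Rightarrow> int list" where
  "flip k = map (\<lambda>x. if \<bar>x\<bar> = k then - x else x)"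

lemma flip_flip [simp]: "flip k (flip k w) = w"
  by (auto simp: flip_def intro!: map_idI)

lemma length_flip [simp]: "length (flip k w) = length w"
  by (simp add: flip_def)

lemma entry_flip:
  "i \<le> length w \<Longrightarrow> entry (flip k w) i = (if \<bar>entry w i\<bar> = k then - entry w i else entry w i)"
  by (cases i) (auto simp: flip_def)

lemma abs_entry_flip: "i \<le> length w \<Longrightarrow> \<bar>entry (flip k w) i\<bar> = \<bar>entry w i\<bar>"
  by (simp add: entry_flip)

lemma flip_signed_perms:
  assumes "w \<in> signed_perms n"
  shows "flip k w \<in> signed_perms n"
proof -
  have "abs ` set (flip k w) = abs ` set w"
    unfolding set_map[symmetric] by (intro arg_cong[where f = set]) (simp add: flip_def)
  with assms show ?thesis
    by (auto simp: signed_perms_def flip_def)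
qed

text \<open>Depends on absolute values only, hence is the same before and after a sign change; this
  is what makes the map an involution. The value is meaningful only if some index \<open>j\<close>
  is displaced.\<close>

definition first_displaced :: "int list \<Rightarrow> nat" where
  "first_displaced w = (LEAST k. k \<le> length w \<and> \<bar>entry w k\<bar> \<noteq> int k)"

lemma first_displaced_flip: "first_displaced (flip k w) = first_displaced w"
proof -
  have "(\<lambda>j. j \<le> length w \<and> \<bar>entry (flip k w) j\<bar> \<noteq> int j)
      = (\<lambda>j. j \<le> length w \<and> \<bar>entry w j\<bar> \<noteq> int j)"
    by (auto simp: abs_entry_flip)
  then show ?thesis by (simp add: first_displaced_def)
qed

lemma first_displaced:
  assumes "j \<le> length w" "\<bar>entry w j\<bar> \<noteq> int j"
  shows "first_displaced w \<le> length w"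
    and "\<bar>entry w (first_displaced w)\<bar> \<noteq> int (first_displaced w)"
  using LeastI[of "\<lambda>k. k \<le> length w \<and> \<bar>entry w k\<bar> \<noteq> int k" j] assms
  by (simp_all add: first_displaced_def)

lemma below_first_displaced:
  assumes "i < first_displaced w" "i \<le> length w"
  shows "\<bar>entry w i\<bar> = int i"
  using assms not_less_Least[of i "\<lambda>k. k \<le> length w \<and> \<bar>entry w k\<bar> \<noteq> int k"]
  by (simp add: first_displaced_def)

lemma first_displaced_beyond:
  assumes "w \<in> signed_perms n" "j \<le> n" "\<bar>entry w j\<bar> \<noteq> int j"
    and "i \<le> n" "\<bar>entry w i\<bar> = int (first_displaced w)"
  shows "first_displaced w < i"
proof (rule ccontr)
  note len = signed_perms_length[OF assms(1)]
  assume "\<not> first_displaced w < i"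
  then consider "i < first_displaced w" | "i = first_displaced w" by linarith
  then show False
  proof cases
    case 1
    then show False using below_first_displaced[of i w] assms len by simp
  next
    case 2
    then show False using first_displaced(2)[of j w] assms len by simp
  qed
qed

text \<open>A smaller absolute value \<open>m\<close> already occurs at position \<open>m\<close>,
  so injectivity would force \<open>i = m\<close>, which lies below the displaced position.\<close>

lemma abs_entry_ge_first_displaced:
  assumes "w \<in> signed_perms n" "i \<le> n" "first_displaced w \<le> i"
  shows "int (first_displaced w) \<le> \<bar>entry w i\<bar>"
proof (rule ccontr)
  assume "\<not> ?thesis"
  then have less: "nat \<bar>entry w i\<bar> < first_displaced w" by linarith
  then have "\<bar>entry w (nat \<bar>entry w i\<bar>)\<bar> = \<bar>entry w i\<bar>"
    using below_first_displaced[OF less] signed_perms_length[OF assms(1)] assms by simp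
  then have "nat \<bar>entry w i\<bar> = i"
    using inj_on_abs_entry[OF assms(1)] assms less by (auto dest: inj_onD)
  with less assms show False by simp
qed

text \<open>A comparison of letters with distinct absolute values is decided by the sign of the
  larger one in absolute value. Next to the negated letter, that is always its neighbour.\<close>

lemma flip_less_iff:
  assumes w: "w \<in> signed_perms n" "j \<le> n" "\<bar>entry w j\<bar> \<noteq> int j" and "i < n"
  defines "k \<equiv> int (first_displaced w)"
  shows "entry (flip k w) i < entry (flip k w) (Suc i) \<longleftrightarrow> entry w i < entry w (Suc i)"
    and "entry (flip k w) (Suc i) < entry (flip k w) i \<longleftrightarrow> entry w (Suc i) < entry w i"
proof -
  have ne: "\<bar>entry w i\<bar> \<noteq> \<bar>entry w (Suc i)\<bar>"
    using inj_onD[OF inj_on_abs_entry[OF w(1)], of i "Suc i"] \<open>i < n\<close> by auto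
  have 1: "k \<le> \<bar>entry w (Suc i)\<bar>" if "\<bar>entry w i\<bar> = k"
    using first_displaced_beyond[OF w, of i] abs_entry_ge_first_displaced[OF w(1), of "Suc i"]
      that \<open>i < n\<close> by (simp add: k_def)
  \<comment> \<open>The left neighbour may sit exactly at the displaced position, which is still
    covered by the lower bound; \<open>ne\<close> then makes the inequality strict.\<close>
  have 2: "k \<le> \<bar>entry w i\<bar>" if "\<bar>entry w (Suc i)\<bar> = k"
    using first_displaced_beyond[OF w, of "Suc i"] abs_entry_ge_first_displaced[OF w(1), of i]
      that \<open>i < n\<close> by (simp add: k_def)
  have *: "entry (flip k w) i = (if \<bar>entry w i\<bar> = k then - entry w i else entry w i)"
    "entry (flip k w) (Suc i) =
      (if \<bar>entry w (Suc i)\<bar> = k then - entry w (Suc i) else entry w (Suc i))"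
    using signed_perms_length[OF w(1)] \<open>i < n\<close> by (simp_all only: entry_flip)
  show "entry (flip k w) i < entry (flip k w) (Suc i) \<longleftrightarrow> entry w i < entry w (Suc i)"
    and "entry (flip k w) (Suc i) < entry (flip k w) i \<longleftrightarrow> entry w (Suc i) < entry w i"
    unfolding * using ne 1 2 by (auto simp del: entry_Suc split: if_splits)
qed

lemma peak_set_flip:
  assumes w: "w \<in> signed_perms n" "j \<le> n" "\<bar>entry w j\<bar> \<noteq> int j"
  shows "peak_set (flip (int (first_displaced w)) w) = peak_set w"
proof -
  let ?v = "flip (int (first_displaced w)) w"
  have "(entry ?v (i - 1) < entry ?v i \<and> entry ?v i > entry ?v (i + 1)) \<longleftrightarrow>
      (entry w (i - 1) < entry w i \<and> entry w i > entry w (i + 1))" if "i \<in> {1..<n}" for i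
    using flip_less_iff(1)[OF w, of "i - 1"] flip_less_iff(2)[OF w, of i] that
    by (auto simp del: entry_Suc)
  then show ?thesis
    unfolding peak_set_def using signed_perms_length[OF w(1)] by (auto simp del: entry_Suc)
qed

section \<open>Reduction to sign patterns on the identity permutation\<close>

definition stair :: "nat \<Rightarrow> int list set" where
  "stair n = {w. length w = n \<and> (\<forall>i\<le>n. \<bar>entry w i\<bar> = int i)}"

lemma stair_subset: "stair n \<subseteq> signed_perms n"
proof
  fix w assume "w \<in> stair n"
  then have len: "length w = n" and abs: "\<And>i. i \<le> n \<Longrightarrow> \<bar>entry w i\<bar> = int i"
    by (simp_all add: stair_def)
  have "set w = (!) w ` {..<n}" using len by (auto simp: in_set_conv_nth)
  then have "abs ` set w = (\<lambda>i. 1 + int i) ` {..<n}"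
    using abs[of "Suc i" for i] by (simp add: image_image)
  also have "\<dots> = {1..int n}"
  proof
    show "{1..int n} \<subseteq> (\<lambda>i. 1 + int i) ` {..<n}"
      by (auto intro!: image_eqI[where x = "nat (x - 1)" for x])
  qed auto
  finally have "abs ` set w = {1..int n}" .
  moreover from this have "\<bar>x\<bar> \<in> {1..int n}" if "x \<in> set w" for x using that by blast
  ultimately show "w \<in> signed_perms n"
    using len by (fastforce simp: signed_perms_def)
qed

lemma even_card_PB_hat_iff:
  "even (card (PB_hat S n)) \<longleftrightarrow> even (card {w \<in> stair n. peak_set w = S})"
proof -
  let ?A = "{w \<in> PB_hat S n. w \<notin> stair n}" and ?B = "{w \<in> stair n. peak_set w = S}"
  have "even (card ?A)"
  proof (rule even_card_involution[where f = "\<lambda>w. flip (int (first_displaced w)) w"])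
    fix w assume "w \<in> ?A"
    then have w: "w \<in> signed_perms n" and S: "peak_set w = S" and "w \<notin> stair n"
      by (simp_all add: PB_hat_def)
    then obtain j where j: "j \<le> n" "\<bar>entry w j\<bar> \<noteq> int j"
      using signed_perms_length[OF w] by (auto simp: stair_def)
    let ?k = "int (first_displaced w)"
    have len: "length w = n" using w by (rule signed_perms_length)
    have "flip ?k w \<notin> stair n" using j len by (auto simp: stair_def abs_entry_flip)
    then show "flip ?k w \<in> ?A"
      using S flip_signed_perms[OF w] peak_set_flip[OF w j] by (simp add: PB_hat_def)
    show "flip (int (first_displaced (flip ?k w))) (flip ?k w) = w"
      by (simp add: first_displaced_flip)
    \<comment> \<open>No fixed points: every absolute value up to \<open>n\<close> occurs, so some
      letter is negated, and \<open>?k\<close> is nonzero because index 0 carries 0.\<close>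
    have "?k \<in> {0..int n}" using first_displaced(1)[of j w] j len by simp
    then obtain i where i: "i \<le> n" "\<bar>entry w i\<bar> = ?k"
      using abs_entry_image[OF w] by (metis (no_types, lifting) atLeastAtMost_iff imageE)
    have "first_displaced w \<noteq> 0"
      using first_displaced(2)[of j w] j len by (metis abs_zero entry_0 of_nat_0)
    with i have "entry (flip ?k w) i \<noteq> entry w i" using len by (simp add: entry_flip)
    then show "flip ?k w \<noteq> w" by auto
  qed
  moreover have "PB_hat S n = ?A \<union> ?B" using stair_subset by (auto simp: PB_hat_def)
  moreover have "finite ?B"
    by (rule finite_subset[OF _ finite_signed_perms[of n]]) (use stair_subset in auto)
  then have "card (?A \<union> ?B) = card ?A + card ?B"
    by (intro card_Un_disjoint) (auto simp: finite_PB_hat)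
  ultimately show ?thesis by simp
qed

section \<open>Recursion on the length, by the sign of the last letter\<close>

definition stair_pos :: "nat set \<Rightarrow> nat \<Rightarrow> int list set" where
  "stair_pos S n = {w \<in> stair n. peak_set w = S \<and> entry w n > 0}"

text \<open>For \<open>n = 0\<close> the last letter is \<open>\<pi>\<^sub>0 = 0\<close>, so the empty word is counted here.\<close>

definition stair_nonpos :: "nat set \<Rightarrow> nat \<Rightarrow> int list set" where
  "stair_nonpos S n = {w \<in> stair n. peak_set w = S \<and> entry w n \<le> 0}"

lemma finite_stair: "finite (stair n)"
  using finite_subset[OF stair_subset finite_signed_perms] .

lemma finite_stair_parts [simp]: "finite (stair_pos S n)" "finite (stair_nonpos S n)"
  by (simp_all add: stair_pos_def stair_nonpos_def finite_stair)

lemma card_stair_peak_set: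
  "card {w \<in> stair n. peak_set w = S} = card (stair_pos S n) + card (stair_nonpos S n)"
proof -
  have "{w \<in> stair n. peak_set w = S} = stair_pos S n \<union> stair_nonpos S n"
    by (auto simp: stair_pos_def stair_nonpos_def)
  moreover have "stair_pos S n \<inter> stair_nonpos S n = {}"
    by (auto simp: stair_pos_def stair_nonpos_def)
  ultimately show ?thesis by (simp add: card_Un_disjoint)
qed

text \<open>Absolute values increase along the word, so the sign of the later letter decides each
  comparison of neighbours. The bound \<open>1 \<le> i\<close> is absorbed because
  \<open>entry w 0 = 0\<close> is not positive.\<close>

lemma peak_set_stair:
  assumes "w \<in> stair n"
  shows "peak_set w = {i. i < n \<and> entry w i > 0 \<and> entry w (Suc i) < 0}"
proof -
  have len: "length w = n" and abs: "\<And>i. i \<le> n \<Longrightarrow> \<bar>entry w i\<bar> = int i"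
    using assms by (auto simp: stair_def)
  have "i \<in> {1..<n} \<and> entry w (i - 1) < entry w i \<and> entry w i > entry w (i + 1) \<longleftrightarrow>
      i < n \<and> entry w i > 0 \<and> entry w (Suc i) < 0" for i
  proof (cases "1 \<le> i \<and> i < n")
    case True
    then have "\<bar>entry w (i - 1)\<bar> = int i - 1" using abs[of "i - 1"] by (simp add: le_diff_conv)
    with True show ?thesis
      using abs[of i] abs[of "Suc i"]
      by (auto simp: abs_if simp del: entry_Suc split: if_splits)
  next
    case False
    then have "i = 0 \<or> n \<le> i" by auto
    then show ?thesis by (auto simp del: entry_Suc)
  qed
  then show ?thesis unfolding peak_set_def len by blast
qed

lemma entry_append: "i \<le> length w \<Longrightarrow> entry (w @ [x]) i = entry w i"
  by (cases i) (simp_all add: nth_append)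

lemma entry_append_last: "entry (w @ [x]) (Suc (length w)) = x"
  by simp

lemma stair_snoc_iff: "w @ [x] \<in> stair (Suc n) \<longleftrightarrow> w \<in> stair n \<and> \<bar>x\<bar> = int (Suc n)"
  using entry_append_last[of w x]
  by (auto simp: stair_def le_Suc_eq entry_append simp del: entry_Suc)

text \<open>Only index \<open>n\<close> gains a right neighbour, so only there can a new peak
  arise.\<close>

lemma peak_set_snoc:
  assumes "w \<in> stair n" "\<bar>x\<bar> = int (Suc n)"
  shows "peak_set (w @ [x]) = peak_set w \<union> (if entry w n > 0 \<and> x < 0 then {n} else {})"
proof -
  have len: "length w = n" using assms(1) by (simp add: stair_def)
  have "w @ [x] \<in> stair (Suc n)" using assms by (simp add: stair_snoc_iff)
  note sets = peak_set_stair[OF this] peak_set_stair[OF assms(1)]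
  have last: "entry (w @ [x]) (Suc n) = x" using entry_append_last[of w x] len by simp
  show ?thesis
  proof (rule set_eqI)
    fix i
    consider "i < n" | "i = n" | "i > n" by linarith
    then show "i \<in> peak_set (w @ [x]) \<longleftrightarrow>
        i \<in> peak_set w \<union> (if entry w n > 0 \<and> x < 0 then {n} else {})"
      by cases (simp_all add: sets entry_append len last del: entry_Suc)
  qed
qed

lemma stair_Suc:
  "stair (Suc n) =
    (\<lambda>w. w @ [int (Suc n)]) ` stair n \<union> (\<lambda>w. w @ [- int (Suc n)]) ` stair n"
proof
  show "stair (Suc n) \<subseteq>
    (\<lambda>w. w @ [int (Suc n)]) ` stair n \<union> (\<lambda>w. w @ [- int (Suc n)]) ` stair n"
  proof
    fix v assume v: "v \<in> stair (Suc n)"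
    then have "v \<noteq> []" by (auto simp: stair_def)
    then obtain w x where "v = w @ [x]" by (metis rev_exhaust)
    moreover from this v have "w \<in> stair n" "x = int (Suc n) \<or> x = - int (Suc n)"
      by (auto simp: stair_snoc_iff)
    ultimately show "v \<in> (\<lambda>w. w @ [int (Suc n)]) ` stair n \<union> (\<lambda>w. w @ [- int (Suc n)]) ` stair n"
      by blast
  qed
qed (auto simp: stair_snoc_iff)

lemma entry_snoc_stair: "w \<in> stair n \<Longrightarrow> entry (w @ [x]) (Suc n) = x"
  using entry_append_last[of w x] by (simp add: stair_def del: entry_Suc)

text \<open>A positive last letter creates no peak, so it may follow a word of either kind.\<close>

lemma card_stair_pos_Suc:
  "card (stair_pos S (Suc n)) = card (stair_pos S n) + card (stair_nonpos S n)"
proof -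
  have "stair_pos S (Suc n) = (\<lambda>w. w @ [int (Suc n)]) ` {w \<in> stair n. peak_set w = S}"
    by (auto simp: stair_pos_def stair_Suc peak_set_snoc entry_snoc_stair simp del: entry_Suc)
  then show ?thesis by (simp add: card_image inj_on_def card_stair_peak_set)
qed

lemma peak_set_stair_subset: "w \<in> stair n \<Longrightarrow> peak_set w \<subseteq> {1..<n}"
  by (auto simp: stair_def peak_set_def)

text \<open>A negative last letter creates a peak at \<open>n\<close> exactly after a positive
  letter, so membership of \<open>n\<close> in \<open>S\<close> dictates the sign before it.\<close>

lemma stair_nonpos_Suc:
  "stair_nonpos S (Suc n) = (\<lambda>w. w @ [- int (Suc n)]) `
    (if n \<in> S then stair_pos (S - {n}) n else stair_nonpos S n)"
proof -
  have n: "n \<notin> peak_set w" if "w \<in> stair n" for w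
    using peak_set_stair_subset[OF that] by auto
  have pos: "\<not> entry (w @ [int (Suc n)]) (Suc n) \<le> 0" if "w \<in> stair n" for w
    using that by (simp add: entry_snoc_stair del: entry_Suc)
  have neg: "peak_set (w @ [- int (Suc n)]) = S \<and> entry (w @ [- int (Suc n)]) (Suc n) \<le> 0 \<longleftrightarrow>
      peak_set w \<union> (if entry w n > 0 then {n} else {}) = S" if "w \<in> stair n" for w
    using that by (simp add: peak_set_snoc entry_snoc_stair del: entry_Suc)
  have "stair_nonpos S (Suc n) = (\<lambda>w. w @ [- int (Suc n)]) `
      {w \<in> stair n. peak_set w \<union> (if entry w n > 0 then {n} else {}) = S}"
    unfolding stair_nonpos_def stair_Suc using pos neg by blast
  also have "{w \<in> stair n. peak_set w \<union> (if entry w n > 0 then {n} else {}) = S} =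
      (if n \<in> S then stair_pos (S - {n}) n else stair_nonpos S n)"
    using n by (auto simp: stair_pos_def stair_nonpos_def not_less split: if_splits)
  finally show ?thesis .
qed

lemma card_stair_nonpos_Suc:
  "card (stair_nonpos S (Suc n)) =
    (if n \<in> S then card (stair_pos (S - {n}) n) else card (stair_nonpos S n))"
  by (simp add: stair_nonpos_Suc card_image inj_on_def)

text \<open>Makes \<open>stair_pos S (Suc n)\<close> empty in the recursion when
  \<open>n \<in> S\<close>.\<close>

lemma stair_parts_empty:
  "n \<in> S \<Longrightarrow> stair_pos S n = {}" "n \<in> S \<Longrightarrow> stair_nonpos S n = {}"
  by (auto simp: stair_pos_def stair_nonpos_def dest!: peak_set_stair_subset)

text \<open>Let \<open>e\<close> be 1 if all of \<open>S\<close> is odd and 0 otherwise. Modulo 2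
  the counts are \<open>e * n\<close> and \<open>e\<close>. If \<open>n \<notin> S\<close>, they
  become \<open>e * n + e\<close> and \<open>e\<close>. If \<open>n \<in> S\<close>, they become 0
  and the positive count for \<open>S - {n}\<close>, whose factor \<open>n\<close> tests the parity
  of the removed peak.\<close>

lemma odd_card_stair_parts:
  assumes "S \<subseteq> {1..<n}"
  shows "odd (card (stair_pos S n)) \<longleftrightarrow> (\<forall>i\<in>S. odd i) \<and> odd n"
    and "odd (card (stair_nonpos S n)) \<longleftrightarrow> (\<forall>i\<in>S. odd i)"
proof -
  have "(odd (card (stair_pos S n)) \<longleftrightarrow> (\<forall>i\<in>S. odd i) \<and> odd n) \<and>
      (odd (card (stair_nonpos S n)) \<longleftrightarrow> (\<forall>i\<in>S. odd i))"
    using assms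
  proof (induction n arbitrary: S)
    case 0
    have "stair 0 = {[]}" by (auto simp: stair_def)
    moreover have "peak_set [] = {}" by (simp add: peak_set_def)
    ultimately have "stair_pos {} 0 = {}" "stair_nonpos {} 0 = {[]}"
      by (auto simp: stair_pos_def stair_nonpos_def)
    with 0 show ?case by simp
  next
    case (Suc n)
    show ?case
    proof (cases "n \<in> S")
      case True
      have "S - {n} \<subseteq> {1..<n}" using Suc.prems by (auto simp: less_Suc_eq)
      moreover have "(\<forall>i\<in>S. odd i) \<longleftrightarrow> (\<forall>i\<in>S - {n}. odd i) \<and> odd n" using True by auto
      ultimately show ?thesis
        using Suc.IH[of "S - {n}"] True
        by (simp add: card_stair_pos_Suc card_stair_nonpos_Suc stair_parts_empty)
    next
      case False
      then have "S \<subseteq> {1..<n}" using Suc.prems by (force simp: less_Suc_eq)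
      from Suc.IH[OF this] False show ?thesis
        by (simp add: card_stair_pos_Suc card_stair_nonpos_Suc) blast
    qed
  qed
  then show "odd (card (stair_pos S n)) \<longleftrightarrow> (\<forall>i\<in>S. odd i) \<and> odd n"
    and "odd (card (stair_nonpos S n)) \<longleftrightarrow> (\<forall>i\<in>S. odd i)" by blast+
qed

theorem theorem3p4:
  fixes n :: nat and S :: "nat set"
  assumes "admissible n S"
  shows "((\<exists>i\<in>S. even i) \<or> odd n \<longrightarrow> even (card (PB_hat S n)))
       \<and> ((\<forall>i\<in>S. odd i) \<and> even n \<longrightarrow> odd (card (PB_hat S n)))"
proof -
  \<comment> \<open>A witness of admissibility bounds \<open>S\<close>, as the parity formulas
    require.\<close>
  obtain w where "w \<in> signed_perms n" "peak_set w = S"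
    using assms by (auto simp: admissible_def PB_hat_def)
  then have "S \<subseteq> {1..<n}" by (auto simp: peak_set_def signed_perms_def)
  \<comment> \<open>The two counts add up to \<open>e * (n + 1)\<close> modulo 2, with
    \<open>e\<close> equal to 1 iff all of \<open>S\<close> is odd.\<close>
  from odd_card_stair_parts[OF this] show ?thesis
    by (auto simp: even_card_PB_hat_iff card_stair_peak_set)
qed

end
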